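(* Let $(X,d)$ be a compact metric space, let $f\colon X\to X$ be continuous and let $\Lambda$ be a closed, nonempty subset of $X$. The following are equivalent: (1) $\Lambda$ is internally chain transitive; (2) $\Lambda$ is weakly incompressible.
   Context: A finite sequence $x_0,\dots,x_m$ in $X$ is an $\varepsilon$-pseudo-orbit ($\varepsilon>0$) if $d(f(x_n),x_{n+1})<\varepsilon$ for $0\le n<m$. A set $\Lambda\subseteq X$ is internally chain transitive if for every pair of points $x,y\in\Lambda$ and every $\varepsilon>0$ there is an $\varepsilon$-pseudo-orbit $x_0=x,x_1,\dots,x_m=y$ with $m\ge1$ and all $x_i\in\Lambda$. A set $\Lambda\subseteq X$ is weakly incompressible if $M\cap\overline{f(\Lambda\setminus M)}\ne\emptyset$ whenever $M$ is a nonempty, closed, proper subset of $\Lambda$.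
   Formalization: The case where Λ is a single point a with f(a) ≠ a is excluded: there Λ is vacuously weakly incompressible but not internally chain transitive, so the equivalence as stated fails. *)

theory Defs
  imports "HOL-Analysis.Analysis"
begin

text \<open>The metric space is a subset X of a type of class \<open>metric_space\<close>, with the induced metric.
  "Closed" and "closure" are always taken in X, i.e. with respect to \<open>top_of_set X\<close>.\<close>

text \<open>Only the values \<open>x 0, \<dots>, x m\<close> matter: the function x encodes a finite sequence.\<close>
definition pseudo_orbit ::
  "'a::metric_space set \<Rightarrow> ('a \<Rightarrow> 'a) \<Rightarrow> real \<Rightarrow> nat \<Rightarrow> (nat \<Rightarrow> 'a) \<Rightarrow> bool" where
  "pseudo_orbit X f \<epsilon> m x \<longleftrightarrow>
     \<epsilon> > 0 \<and> (\<forall>n\<le>m. x n \<in> X) \<and> (\<forall>n<m. dist (f (x n)) (x (Suc n)) < \<epsilon>)"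

definition internally_chain_transitive ::
  "'a::metric_space set \<Rightarrow> ('a \<Rightarrow> 'a) \<Rightarrow> 'a set \<Rightarrow> bool" where
  "internally_chain_transitive X f \<Lambda> \<longleftrightarrow>
     (\<forall>x\<in>\<Lambda>. \<forall>y\<in>\<Lambda>. \<forall>\<epsilon>>0. \<exists>m\<ge>1. \<exists>p.
        pseudo_orbit X f \<epsilon> m p \<and> p 0 = x \<and> p m = y \<and> (\<forall>i\<le>m. p i \<in> \<Lambda>))"

definition weakly_incompressible ::
  "'a::metric_space set \<Rightarrow> ('a \<Rightarrow> 'a) \<Rightarrow> 'a set \<Rightarrow> bool" where
  "weakly_incompressible X f \<Lambda> \<longleftrightarrow>
     (\<forall>M. M \<noteq> {} \<and> closedin (top_of_set X) M \<and> M \<subset> \<Lambda> \<longrightarrow>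
        M \<inter> (top_of_set X closure_of (f ` (\<Lambda> - M))) \<noteq> {})"

text \<open>A singleton has no nonempty proper subset, so it is vacuously weakly incompressible, whereas it is
  internally chain transitive only if its point is fixed. Hence the two notions differ for a
  singleton whose point is not fixed, and this case has to be excluded from the equivalence.\<close>

lemma weakly_incompressible_singleton: "weakly_incompressible X f {a}"
  unfolding weakly_incompressible_def by blast

lemma internally_chain_transitive_singleton:
  assumes "a \<in> X"
  shows "internally_chain_transitive X f {a} \<longleftrightarrow> f a = a"
proof
  assume ict: "internally_chain_transitive X f {a}"
  have "dist (f a) a < e" if e: "e > 0" for e
  proof -
    obtain m p where "m \<ge> 1" and o: "pseudo_orbit X f e m p" and "\<forall>i\<le>m. p i \<in> {a}"
      using ict e unfolding internally_chain_transitive_def by blast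
    then have "0 < m" and p: "p 0 = a" "p (Suc 0) = a"
      by auto
    then have "dist (f (p 0)) (p (Suc 0)) < e"
      using o unfolding pseudo_orbit_def by blast
    then show ?thesis
      using p by simp
  qed
  then show "f a = a"
    by (metis dist_pos_lt less_irrefl)
next
  assume "f a = a"
  then have "pseudo_orbit X f e 1 (\<lambda>_. a)" if "e > 0" for e
    using assms that unfolding pseudo_orbit_def by auto
  then show "internally_chain_transitive X f {a}"
    unfolding internally_chain_transitive_def by fastforce
qed

end

theory Submission
  imports Defs
begin

text \<open>Both properties say that no nonempty, relatively open, proper subset of \<open>\<Lambda>\<close> can trap
  the \<open>\<epsilon>\<close>-pseudo-orbits in \<open>\<Lambda>\<close>, however small \<open>\<epsilon>\<close> is.

  If \<open>\<Lambda>\<close> is not weakly incompressible, some nonempty, closed, proper subset \<open>M\<close> is disjoint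
  from the closure of \<open>f ` (\<Lambda> - M)\<close>. By compactness the two are a positive distance \<open>e\<close> apart, so an
  \<open>e\<close>-pseudo-orbit in \<open>\<Lambda>\<close> that starts outside \<open>M\<close> never enters \<open>M\<close>, which contradicts chain
  transitivity.

  Conversely, fix \<open>x\<close> and \<open>\<epsilon>\<close>, and let \<open>U\<close> be the set of points of \<open>\<Lambda>\<close> that are reached from \<open>x\<close>
  by an \<open>\<epsilon>\<close>-pseudo-orbit in \<open>\<Lambda>\<close> of positive length. It is relatively open because the last
  point may move a little. Were it a nonempty proper subset, weak incompressibility of \<open>\<Lambda>\<close>,
  applied to \<open>M = \<Lambda> - U\<close>, would give points of \<open>f ` U\<close> arbitrarily close to \<open>\<Lambda> - U\<close>, hence a
  pseudo-orbit that leaves \<open>U\<close> in one more step, which is absurd.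
  That \<open>U\<close> is nonempty means that \<open>f x\<close> lies within \<open>\<epsilon>\<close> of \<open>\<Lambda>\<close>. If \<open>\<Lambda> = {x}\<close>, this holds
  because \<open>x\<close> is fixed; otherwise weak incompressibility, applied to the complement of a small ball
  around \<open>x\<close>, and continuity of \<open>f\<close> at \<open>x\<close> give it.\<close>

definition chain_reaches ::
  "'a::metric_space set \<Rightarrow> ('a \<Rightarrow> 'a) \<Rightarrow> 'a set \<Rightarrow> real \<Rightarrow> 'a \<Rightarrow> 'a \<Rightarrow> bool" where
  "chain_reaches X f \<Lambda> \<epsilon> x y \<longleftrightarrow>
     (\<exists>m\<ge>1. \<exists>p. pseudo_orbit X f \<epsilon> m p \<and> p 0 = x \<and> p m = y \<and> (\<forall>i\<le>m. p i \<in> \<Lambda>))"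

lemma chain_reaches_step:
  assumes "\<Lambda> \<subseteq> X" "x \<in> \<Lambda>" "y \<in> \<Lambda>" "dist (f x) y < \<epsilon>"
  shows "chain_reaches X f \<Lambda> \<epsilon> x y"
proof -
  let ?p = "\<lambda>i::nat. if i = 0 then x else y"
  have "\<epsilon> > 0"
    using assms(4) zero_le_dist[of "f x" y] by linarith
  then have "pseudo_orbit X f \<epsilon> 1 ?p"
    using assms unfolding pseudo_orbit_def by auto
  moreover have "?p 0 = x" "?p 1 = y" "\<forall>i\<le>1. ?p i \<in> \<Lambda>"
    using assms by auto
  ultimately show ?thesis
    unfolding chain_reaches_def by blast
qed

lemma chain_reaches_extend:
  assumes "\<Lambda> \<subseteq> X" "chain_reaches X f \<Lambda> \<epsilon> x z" "y \<in> \<Lambda>" "dist (f z) y < \<epsilon>"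
  shows "chain_reaches X f \<Lambda> \<epsilon> x y"
proof -
  obtain m p where "m \<ge> 1" and p: "pseudo_orbit X f \<epsilon> m p" "p 0 = x" "p m = z" "\<forall>i\<le>m. p i \<in> \<Lambda>"
    using assms(2) unfolding chain_reaches_def by blast
  let ?q = "p(Suc m := y)"
  have "pseudo_orbit X f \<epsilon> (Suc m) ?q"
    using p assms unfolding pseudo_orbit_def by (auto simp: less_Suc_eq le_Suc_eq)
  moreover have "?q 0 = x" "?q (Suc m) = y" "\<forall>i\<le>Suc m. ?q i \<in> \<Lambda>"
    using p assms by (auto simp: le_Suc_eq)
  ultimately show ?thesis
    unfolding chain_reaches_def by (metis le_add1 plus_1_eq_Suc)
qed

lemma internally_chain_transitive_iff_chain_reaches:
  "internally_chain_transitive X f \<Lambda> \<longleftrightarrow>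
     (\<forall>x\<in>\<Lambda>. \<forall>y\<in>\<Lambda>. \<forall>\<epsilon>>0. chain_reaches X f \<Lambda> \<epsilon> x y)"
  unfolding internally_chain_transitive_def chain_reaches_def ..

lemma internally_chain_transitive_imp_weakly_incompressible:
  assumes "compact X" "f \<in> X \<rightarrow> X" "\<Lambda> \<subseteq> X"
    and ict: "internally_chain_transitive X f \<Lambda>"
  shows "weakly_incompressible X f \<Lambda>"
  unfolding weakly_incompressible_def
proof (intro allI impI notI, elim conjE)
  fix M assume "M \<noteq> {}" and M: "closedin (top_of_set X) M" "M \<subset> \<Lambda>"
    and disj: "M \<inter> (top_of_set X closure_of (f ` (\<Lambda> - M))) = {}"
  let ?K = "closure (f ` (\<Lambda> - M))"
  have "f ` (\<Lambda> - M) \<subseteq> X"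
    using assms by blast
  then have "M \<inter> ?K = {}"
    using disj M assms(3) by (auto simp: closure_of_subtopology Int_absorb1)
  moreover have "compact M"
    using M(1) \<open>compact X\<close> closedin_compact by blast
  ultimately obtain e where "e > 0" and e: "(\<Union>y\<in>M. ball y e) \<subseteq> - ?K"
    using compact_subset_open_imp_ball_epsilon_subset[of M "- ?K"]
    by (metis closed_closure disjoint_eq_subset_Compl open_Compl)
  obtain x y where "x \<in> \<Lambda> - M" "y \<in> M"
    using M(2) \<open>M \<noteq> {}\<close> by blast
  then have "chain_reaches X f \<Lambda> e x y"
    using ict M(2) \<open>e > 0\<close> by (auto simp: internally_chain_transitive_iff_chain_reaches)
  then obtain m p where p: "pseudo_orbit X f e m p" "p 0 = x" "p m = y" "\<forall>i\<le>m. p i \<in> \<Lambda>"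
    unfolding chain_reaches_def by blast
  have "p i \<notin> M" if "i \<le> m" for i
    using that
  proof (induction i)
    case 0
    then show ?case
      using p(2) \<open>x \<in> \<Lambda> - M\<close> by simp
  next
    case (Suc i)
    then have "p i \<in> \<Lambda> - M"
      using p(4) by simp
    then have "f (p i) \<in> ?K"
      by (simp add: closure_subset[THEN subsetD])
    moreover have "dist (p (Suc i)) (f (p i)) < e"
      using p(1) Suc.prems by (simp add: pseudo_orbit_def dist_commute)
    ultimately show ?case
      using e by (meson ComplD UN_I mem_ball subsetD)
  qed
  then show False
    using p(3) \<open>y \<in> M\<close> by blast
qed

text \<open>The complement of \<open>V\<close> in \<open>\<Lambda>\<close> is an admissible \<open>M\<close> in the definition of weak
  incompressibility; a point in the intersection it provides is a limit of images of
  points of \<open>\<Lambda> \<inter> V\<close>.\<close>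

lemma weakly_incompressible_escape:
  assumes wi: "weakly_incompressible X f \<Lambda>" and \<Lambda>: "closedin (top_of_set X) \<Lambda>"
    and "open V" "\<Lambda> \<inter> V \<noteq> {}" "\<Lambda> - V \<noteq> {}" "e > 0"
  obtains z y where "z \<in> \<Lambda> \<inter> V" "y \<in> \<Lambda> - V" "dist (f z) y < e"
proof -
  have "closedin (top_of_set X) (\<Lambda> \<inter> (- V))"
    using \<Lambda> \<open>open V\<close> by (auto simp: closedin_closed)
  then have "closedin (top_of_set X) (\<Lambda> - V)"
    by (simp add: Diff_eq)
  moreover have "\<Lambda> - V \<subset> \<Lambda>"
    using assms by blast
  ultimately have "(\<Lambda> - V) \<inter> (top_of_set X closure_of (f ` (\<Lambda> - (\<Lambda> - V)))) \<noteq> {}"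
    using wi[unfolded weakly_incompressible_def, rule_format, of "\<Lambda> - V"] \<open>\<Lambda> - V \<noteq> {}\<close>
    by simp
  then obtain y where "y \<in> \<Lambda> - V" "y \<in> closure (X \<inter> f ` (\<Lambda> - (\<Lambda> - V)))"
    unfolding closure_of_subtopology euclidean_closure_of by blast
  moreover from this obtain b where "b \<in> f ` (\<Lambda> - (\<Lambda> - V))" "dist b y < e"
    using \<open>e > 0\<close> unfolding closure_approachable by blast
  ultimately obtain z where "z \<in> \<Lambda> \<inter> V" "dist (f z) y < e"
    by blast
  with \<open>y \<in> \<Lambda> - V\<close> show thesis
    using that by blast
qed

text \<open>This provides the first step of a pseudo-orbit that starts at \<open>x\<close>. A ball around \<open>x\<close> that
  misses some point of \<open>\<Lambda>\<close> contains a point \<open>z\<close> of \<open>\<Lambda>\<close> with \<open>f z\<close> close to \<open>\<Lambda>\<close>, and \<open>f z\<close> is close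
  to \<open>f x\<close> if the ball is small.\<close>

lemma weakly_incompressible_image_near:
  assumes wi: "weakly_incompressible X f \<Lambda>" and \<Lambda>: "closedin (top_of_set X) \<Lambda>"
    and cont: "continuous_on X f" and fix_singleton: "\<And>a. \<Lambda> = {a} \<Longrightarrow> f a = a"
    and "x \<in> \<Lambda>" "\<epsilon> > 0"
  obtains y where "y \<in> \<Lambda>" "dist (f x) y < \<epsilon>"
proof (cases "\<Lambda> = {x}")
  case True
  then show thesis
    using fix_singleton[of x] that[of x] \<open>\<epsilon> > 0\<close> by simp
next
  case False
  then obtain w where w: "w \<in> \<Lambda>" "w \<noteq> x"
    using \<open>x \<in> \<Lambda>\<close> by blast
  have "\<Lambda> \<subseteq> X"
    using \<Lambda> closedin_subset by fastforce
  then obtain d where "d > 0" and d: "\<forall>z\<in>X. dist z x < d \<longrightarrow> dist (f z) (f x) < \<epsilon> / 2"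
    using cont[unfolded continuous_on_iff, rule_format, of x "\<epsilon> / 2"] \<open>x \<in> \<Lambda>\<close> \<open>\<epsilon> > 0\<close>
    by (auto simp: subset_iff)
  \<comment> \<open>A radius of at most \<open>dist x w\<close> leaves \<open>w\<close> outside the ball.\<close>
  let ?V = "ball x (min d (dist x w))"
  have "x \<in> \<Lambda> \<inter> ?V" "w \<in> \<Lambda> - ?V"
    using w \<open>x \<in> \<Lambda>\<close> \<open>d > 0\<close> by auto
  then obtain z y where z: "z \<in> \<Lambda> \<inter> ?V" and y: "y \<in> \<Lambda> - ?V" and zy: "dist (f z) y < \<epsilon> / 2"
    using weakly_incompressible_escape[OF wi \<Lambda>, of ?V "\<epsilon> / 2"] \<open>\<epsilon> > 0\<close>
    by (metis empty_iff half_gt_zero open_ball)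
  have "dist (f z) (f x) < \<epsilon> / 2"
    using d z \<open>\<Lambda> \<subseteq> X\<close> by (auto simp: dist_commute)
  then have "dist (f x) y < \<epsilon>"
    using zy by (metis dist_commute dist_triangle_half_r)
  then show thesis
    using that y by blast
qed

lemma weakly_incompressible_imp_internally_chain_transitive:
  assumes wi: "weakly_incompressible X f \<Lambda>" and \<Lambda>: "closedin (top_of_set X) \<Lambda>"
    and cont: "continuous_on X f" and fix_singleton: "\<And>a. \<Lambda> = {a} \<Longrightarrow> f a = a"
  shows "internally_chain_transitive X f \<Lambda>"
  unfolding internally_chain_transitive_iff_chain_reaches
proof (intro ballI allI impI)
  fix x y \<epsilon> assume "x \<in> \<Lambda>" "y \<in> \<Lambda>" and "(\<epsilon>::real) > 0"
  have "\<Lambda> \<subseteq> X"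
    using \<Lambda> closedin_subset by fastforce
  let ?R = "{z. z = x \<or> chain_reaches X f \<Lambda> \<epsilon> x z}"
  \<comment> \<open>The points of \<open>\<Lambda>\<close> in the open set \<open>?V\<close> are exactly the reachable ones.\<close>
  let ?V = "\<Union>z\<in>?R. ball (f z) \<epsilon>"
  have reach: "chain_reaches X f \<Lambda> \<epsilon> x v" if "v \<in> \<Lambda> \<inter> ?V" for v
    using that \<open>x \<in> \<Lambda>\<close> chain_reaches_step[OF \<open>\<Lambda> \<subseteq> X\<close>] chain_reaches_extend[OF \<open>\<Lambda> \<subseteq> X\<close>]
    by auto
  have "y \<in> ?V"
  proof (rule ccontr)
    assume "y \<notin> ?V"
    obtain u where "u \<in> \<Lambda>" "dist (f x) u < \<epsilon>"
      using weakly_incompressible_image_near[OF wi \<Lambda> cont fix_singleton \<open>x \<in> \<Lambda>\<close> \<open>\<epsilon> > 0\<close>] .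
    then have "u \<in> \<Lambda> \<inter> ?V"
      by auto
    then have meets: "\<Lambda> \<inter> ?V \<noteq> {}"
      by blast
    have op: "open ?V"
      by blast
    have misses: "\<Lambda> - ?V \<noteq> {}"
      using \<open>y \<in> \<Lambda>\<close> \<open>y \<notin> ?V\<close> by blast
    obtain z v where z: "z \<in> \<Lambda> \<inter> ?V" and v: "v \<in> \<Lambda> - ?V" "dist (f z) v < \<epsilon>"
      using weakly_incompressible_escape[OF wi \<Lambda> op meets misses \<open>\<epsilon> > 0\<close>] .
    have "v \<in> ?V"
      using reach[OF z] v(2) by auto
    with v(1) show False
      by blast
  qed
  then show "chain_reaches X f \<Lambda> \<epsilon> x y"
    using reach \<open>y \<in> \<Lambda>\<close> by blast
qed

theorem theorem2p2:
  fixes X \<Lambda> :: "'a::metric_space set" and f :: "'a \<Rightarrow> 'a"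
  assumes "compact X"
    and "f \<in> X \<rightarrow> X"
    and "continuous_on X f"
    and "closedin (top_of_set X) \<Lambda>"
    and "\<Lambda> \<noteq> {}"
    and "\<And>a. \<Lambda> = {a} \<Longrightarrow> f a = a"
  shows "internally_chain_transitive X f \<Lambda> \<longleftrightarrow> weakly_incompressible X f \<Lambda>"
proof
  have "\<Lambda> \<subseteq> X"
    using assms(4) closedin_subset by fastforce
  show "weakly_incompressible X f \<Lambda>" if "internally_chain_transitive X f \<Lambda>"
    using internally_chain_transitive_imp_weakly_incompressible[OF assms(1,2) \<open>\<Lambda> \<subseteq> X\<close> that] .
  show "internally_chain_transitive X f \<Lambda>" if "weakly_incompressible X f \<Lambda>"
    using weakly_incompressible_imp_internally_chain_transitive[OF that assms(4,3,6)] .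
qed

end
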